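(* Let $\mathcal{C}(n)$ denote the set of isomorphism classes of Catalan pairs of size $n$. For any $n\in\mathbb{N}$ (including $n=0$), $$|\mathcal{C}(n+1)|=\sum_{k=0}^{n}|\mathcal{C}(k)|\cdot|\mathcal{C}(n-k)|.$$ Since $|\mathcal{C}(0)|=1$, it follows that $|\mathcal{C}(n)|=C_n$ for every $n\ge 0$, where $C_n$ is the $n$-th Catalan number (the sequence starting $1,1,2,5,14,42,\ldots$ for $n=0,1,2,\ldots$, with generating function $\frac{1-\sqrt{1-4x}}{2x}$).
   Context: For a finite set $X$, let $\mathcal{D}=\{(x,x)\mid x\in X\}$; for a binary relation $\theta$ on $X$ let $\overline{\theta}=\theta\cup\theta^{-1}$; for binary relations $A,B$ on $X$, $A\circ B=\{(x,z)\mid \exists y\in X:\ xAy \text{ and } yBz\}$. Let $\mathcal{O}(X)$ be the set of strict order relations on $X$ (irreflexive and transitive binary relations). A Catalan pair on $X$ is an ordered pair $(S,R)$ of binary relations on $X$ such that: (ord S) $S\in\mathcal{O}(X)$; (ord R) $R\in\mathcal{O}(X)$; (tot) $\overline{R}\cup\overline{S}=X^2\setminus\mathcal{D}$; (inters) $\overline{R}\cap\overline{S}=\emptyset$; (comp) $S\circ R\subseteq R$. Its size is $|X|$ (the empty pair on the empty set has size $0$). Two Catalan pairs $(S_1,R_1)$ on $X_1$ and $(S_2,R_2)$ on $X_2$ are isomorphic if there is a bijection $\xi:X_1\to X_2$ such that $xS_1y\iff \xi(x)S_2\xi(y)$ and $xR_1y\iff\xi(x)R_2\xi(y)$. *)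

theory Defs
  imports Complex_Main "HOL-Computational_Algebra.Formal_Power_Series"
begin

definition strict_order_on :: "'a set \<Rightarrow> 'a rel \<Rightarrow> bool" where
  "strict_order_on X \<theta> \<longleftrightarrow> \<theta> \<subseteq> X \<times> X \<and> irrefl \<theta> \<and> trans \<theta>"

definition sym_hull :: "'a rel \<Rightarrow> 'a rel" where
  "sym_hull \<theta> = \<theta> \<union> \<theta>\<inverse>"

definition catalan_pair :: "'a set \<Rightarrow> 'a rel \<Rightarrow> 'a rel \<Rightarrow> bool" where
  "catalan_pair X S R \<longleftrightarrow>
     finite X \<and>
     strict_order_on X S \<and>
     strict_order_on X R \<and>
     sym_hull R \<union> sym_hull S = X \<times> X - Id_on X \<and>
     sym_hull R \<inter> sym_hull S = {} \<and>
     S O R \<subseteq> R"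

text \<open>The two carriers may have different types.\<close>

definition catalan_isomorphic ::
    "'a set \<times> 'a rel \<times> 'a rel \<Rightarrow> 'b set \<times> 'b rel \<times> 'b rel \<Rightarrow> bool" where
  "catalan_isomorphic = (\<lambda>(X1, S1, R1) (X2, S2, R2).
     \<exists>\<xi>. bij_betw \<xi> X1 X2 \<and>
         (\<forall>x\<in>X1. \<forall>y\<in>X1. ((x, y) \<in> S1 \<longleftrightarrow> (\<xi> x, \<xi> y) \<in> S2) \<and>
                         ((x, y) \<in> R1 \<longleftrightarrow> (\<xi> x, \<xi> y) \<in> R2)))"

text \<open>
  Isomorphism classes over all finite sets do not form a set of any single type. We
  let the carriers range over the finite subsets of \<^typ>\<open>nat\<close>; by
  \<open>catalan_pair_nat_representative\<close> below, every Catalan pair on a finite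
  set of any type has a representative among these.
\<close>

definition catalan_pairs :: "nat \<Rightarrow> (nat set \<times> nat rel \<times> nat rel) set" where
  "catalan_pairs n = {(X, S, R). catalan_pair X S R \<and> card X = n}"

definition catalan_iso_rel :: "nat \<Rightarrow> (nat set \<times> nat rel \<times> nat rel) rel" where
  "catalan_iso_rel n = {(P, Q) \<in> catalan_pairs n \<times> catalan_pairs n. catalan_isomorphic P Q}"

definition catalan_classes :: "nat \<Rightarrow> (nat set \<times> nat rel \<times> nat rel) set set" where
  "catalan_classes n = catalan_pairs n // catalan_iso_rel n"

text \<open>
  The generating function \<open>(1 - sqrt (1 - 4 * x)) / (2 * x)\<close>, with the square root
  that has constant term 1. The division is exact, since the numerator has constant term 0.
\<close>

definition catalan_gf :: "real fps" where
  "catalan_gf = (1 - fps_radical root 2 (1 - 4 * fps_X)) / (2 * fps_X)"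

definition catalan_number :: "nat \<Rightarrow> real" where
  "catalan_number n = fps_nth catalan_gf n"

lemma catalan_isomorphic_pair:
  assumes "catalan_pair X S R" and "inj_on f X"
  shows "catalan_pair (f ` X) (map_prod f f ` S) (map_prod f f ` R)"
    and "catalan_isomorphic (X, S, R) (f ` X, map_prod f f ` S, map_prod f f ` R)"
proof -
  have sub: "S \<subseteq> X \<times> X" "R \<subseteq> X \<times> X"
    using assms(1) by (auto simp: catalan_pair_def strict_order_on_def)
  have mem: "(f x, f y) \<in> map_prod f f ` T \<longleftrightarrow> (x, y) \<in> T"
    if "T \<subseteq> X \<times> X" "x \<in> X" "y \<in> X" for T x y
  proof
    assume "(f x, f y) \<in> map_prod f f ` T"
    then obtain a b where "(a, b) \<in> T" "f a = f x" "f b = f y" by auto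
    moreover then have "a = x" "b = y"
      using that assms(2) by (auto simp: inj_on_def)
    ultimately show "(x, y) \<in> T" by simp
  qed force
  show "catalan_isomorphic (X, S, R) (f ` X, map_prod f f ` S, map_prod f f ` R)"
    unfolding catalan_isomorphic_def prod.case
    by (intro exI[of _ f] conjI ballI inj_on_imp_bij_betw[OF assms(2)]
          mem[OF sub(1), symmetric] mem[OF sub(2), symmetric])
  have so: "strict_order_on (f ` X) (map_prod f f ` T)" if "strict_order_on X T" for T
  proof -
    have T: "T \<subseteq> X \<times> X" "irrefl T" "trans T"
      using that by (auto simp: strict_order_on_def)
    have "map_prod f f ` T \<subseteq> f ` X \<times> f ` X" using T(1) by auto
    moreover have "irrefl (map_prod f f ` T)"
    proof (rule irreflI)
      fix u show "(u, u) \<notin> map_prod f f ` T"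
      proof
        assume "(u, u) \<in> map_prod f f ` T"
        then obtain a b where "(a, b) \<in> T" "u = f a" "u = f b" by auto
        with T(1) have "a = b" using inj_onD[OF assms(2), of a b] by auto
        with \<open>(a, b) \<in> T\<close> T(2) show False by (auto simp: irrefl_def)
      qed
    qed
    moreover have "trans (map_prod f f ` T)"
    proof (rule transI)
      fix u v w assume uv: "(u, v) \<in> map_prod f f ` T" and vw: "(v, w) \<in> map_prod f f ` T"
      from uv obtain a b where ab: "(a, b) \<in> T" "u = f a" "v = f b" by auto
      from vw obtain c d where cd: "(c, d) \<in> T" "v = f c" "w = f d" by auto
      have "b = c" using ab cd T(1) inj_onD[OF assms(2), of b c] by auto
      then have "(a, d) \<in> T" using ab cd T(3) by (auto dest: transD)
      then show "(u, w) \<in> map_prod f f ` T" using ab cd by force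
    qed
    ultimately show ?thesis by (simp add: strict_order_on_def)
  qed
  have conv: "(map_prod f f ` T)\<inverse> = map_prod f f ` T\<inverse>" for T
    by auto
  have hull: "sym_hull (map_prod f f ` T) = map_prod f f ` sym_hull T" for T
    by (simp add: sym_hull_def conv image_Un)
  have inj: "inj_on (map_prod f f) (X \<times> X)"
    using assms(2) by (simp add: map_prod_inj_on)
  have hull_sub: "sym_hull S \<subseteq> X \<times> X" "sym_hull R \<subseteq> X \<times> X"
    using sub by (auto simp: sym_hull_def)
  have tot: "sym_hull (map_prod f f ` R) \<union> sym_hull (map_prod f f ` S)
      = f ` X \<times> f ` X - Id_on (f ` X)"
  proof -
    have "sym_hull (map_prod f f ` R) \<union> sym_hull (map_prod f f ` S)
        = map_prod f f ` (X \<times> X - Id_on X)"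
      using assms(1) unfolding hull image_Un[symmetric] by (simp add: catalan_pair_def)
    also have "\<dots> = map_prod f f ` (X \<times> X) - map_prod f f ` Id_on X"
      by (rule inj_on_image_set_diff[OF inj]) auto
    also have "map_prod f f ` Id_on X = Id_on (f ` X)"
      by (auto simp: Id_on_def image_UN)
    finally show ?thesis by (simp add: map_prod_surj_on)
  qed
  have inters: "sym_hull (map_prod f f ` R) \<inter> sym_hull (map_prod f f ` S) = {}"
    unfolding hull inj_on_image_Int[OF inj hull_sub(2,1), symmetric]
    using assms(1) by (simp add: catalan_pair_def)
  have comp: "map_prod f f ` S O map_prod f f ` R \<subseteq> map_prod f f ` R"
  proof clarify
    fix a b c d assume *: "(a, b) \<in> S" "(c, d) \<in> R" "f b = f c"
    have "b = c" using * sub inj_onD[OF assms(2), of b c] by auto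
    then have "(a, d) \<in> R" using * assms(1) by (auto simp: catalan_pair_def)
    then show "(f a, f d) \<in> map_prod f f ` R" by force
  qed
  show "catalan_pair (f ` X) (map_prod f f ` S) (map_prod f f ` R)"
    using assms(1) so tot inters comp by (simp add: catalan_pair_def)
qed

lemma catalan_pair_nat_representative:
  assumes "catalan_pair X S R"
  shows "\<exists>P \<in> catalan_pairs (card X). catalan_isomorphic (X, S, R) P"
proof -
  have "finite X" using assms by (simp add: catalan_pair_def)
  then obtain f :: "'a \<Rightarrow> nat" where f: "inj_on f X"
    using finite_imp_inj_to_nat_seg by blast
  have "(f ` X, map_prod f f ` S, map_prod f f ` R) \<in> catalan_pairs (card X)"
    using catalan_isomorphic_pair(1)[OF assms f] by (simp add: catalan_pairs_def card_image[OF f])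
  then show ?thesis
    using catalan_isomorphic_pair(2)[OF assms f] by blast
qed

lemma catalan_gf_quadratic: "catalan_gf = 1 + fps_X * catalan_gf\<^sup>2"
proof -
  define s :: "real fps" where "s = fps_radical root 2 (1 - 4 * fps_X)"
  have sq: "s\<^sup>2 = 1 - 4 * fps_X"
    unfolding s_def
    using power_radical[of "1 - 4 * fps_X :: real fps" root 1]
    by (simp add: numeral_2_eq_2)
  have s0: "fps_nth s 0 = 1"
    by (simp add: s_def)
  have "1 - s = fps_X * fps_shift 1 (1 - s)"
    by (rule fps_ext) (simp add: s0)
  moreover have "2 * fps_const (1 / 2) = (1 :: real fps)"
    by (simp add: fps_numeral_fps_const)
  ultimately have "1 - s = 2 * fps_X * (fps_const (1 / 2) * fps_shift 1 (1 - s))"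
    by (simp add: mult.assoc mult.left_commute[of fps_X])
  then have "2 * fps_X dvd 1 - s"
    by (rule dvdI)
  then have gf: "2 * fps_X * catalan_gf = 1 - s"
    by (simp add: catalan_gf_def s_def)
  have "4 * fps_X * (fps_X * catalan_gf\<^sup>2) = (2 * fps_X * catalan_gf)\<^sup>2"
    by (simp add: power2_eq_square algebra_simps)
  also have "\<dots> = 1 - 2 * s + s\<^sup>2"
    unfolding gf by (simp add: power2_eq_square algebra_simps)
  also have "\<dots> = 2 * (1 - s) - 4 * fps_X"
    unfolding sq by simp
  also have "\<dots> = 4 * fps_X * (catalan_gf - 1)"
    unfolding gf[symmetric] by (simp add: algebra_simps)
  finally have "4 * fps_X * (fps_X * catalan_gf\<^sup>2) = 4 * fps_X * (catalan_gf - 1)" .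
  moreover have "4 * fps_X \<noteq> (0 :: real fps)"
    by simp
  ultimately have "fps_X * catalan_gf\<^sup>2 = catalan_gf - 1"
    unfolding mult_cancel_left by blast
  then show ?thesis
    by simp
qed

lemma catalan_number_values:
  "map catalan_number [0..<6] = [1, 1, 2, 5, 14, 42]"
proof -
  have 0: "catalan_number 0 = 1"
    unfolding catalan_number_def by (subst catalan_gf_quadratic) simp
  have Suc: "catalan_number (Suc n) = (\<Sum>k=0..n. catalan_number k * catalan_number (n - k))" for n
    unfolding catalan_number_def
    by (subst catalan_gf_quadratic) (simp, simp add: power2_eq_square fps_mult_nth)
  show ?thesis
    by (simp add: 0 Suc upt_rec numeral_eq_Suc atLeast0_atMost_Suc atLeastAtMost_singleton)
qed

end

theory Submission
  imports Defs
begin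

text \<open>
  The union of the two relations of a Catalan pair is a strict linear order, so a finite Catalan
  pair has no nontrivial automorphism and is isomorphic to exactly one pair on \<open>{..<n}\<close> whose
  union is the usual order \<open><\<close> (\<open>catalan_pair_trans_Un\<close>, \<open>finite_linear_order_rank\<close>).
  For such a pair, (comp) and transitivity of \<open>R\<close> together say that the \<open>R\<close>-predecessors of
  each \<open>z\<close> form an initial segment \<open>{..<r z}\<close>; the \<open>S\<close>-predecessors are then the remaining
  elements \<open>r z, \<dots>, z - 1\<close>, and transitivity of \<open>S\<close> becomes the condition that the intervals
  \<open>[r z, z]\<close> are pairwise nested or disjoint. Isomorphism classes of size \<open>n\<close> thus correspond
  to the laminar families of intervals in which every \<open>z < n\<close> is the right end of exactly one
  interval (\<open>card_catalan_classes\<close>).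

  These families satisfy the Catalan recurrence: the interval \<open>[k, n]\<close> with the largest right
  end splits the others into those to the left of \<open>k\<close>, a family of size \<open>k\<close>, and those contained
  in it, a shifted family of size \<open>n - k\<close>, and these two can be chosen independently
  (\<open>card_laminar_Suc\<close>). The generating function obeys the same recurrence, by its quadratic
  equation.
\<close>

section \<open>Laminar families of intervals\<close>

text \<open>
  The list stores left ends: position \<open>z\<close> holds the left end of the interval with right end \<open>z\<close>.
  Two intervals with right ends \<open>y < z\<close> meet iff \<open>r ! z \<le> y\<close>, and then the condition says that
  the first is contained in the second.
\<close>

definition laminar :: "nat list \<Rightarrow> bool" where
  "laminar r \<longleftrightarrow> (\<forall>z<length r. r ! z \<le> z \<and> (\<forall>y<z. r ! z \<le> y \<longrightarrow> r ! z \<le> r ! y))"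

definition laminar_lists :: "nat \<Rightarrow> nat list set" where
  "laminar_lists n = {r. laminar r \<and> length r = n}"

lemma laminar_le: "laminar r \<Longrightarrow> z < length r \<Longrightarrow> r ! z \<le> z"
  by (simp add: laminar_def)

lemma laminar_nested:
  "laminar r \<Longrightarrow> y < z \<Longrightarrow> z < length r \<Longrightarrow> r ! z \<le> y \<Longrightarrow> r ! z \<le> r ! y"
  by (simp add: laminar_def)

lemma finite_laminar_lists: "finite (laminar_lists n)"
proof (rule finite_subset)
  show "laminar_lists n \<subseteq> {r. set r \<subseteq> {..n} \<and> length r = n}"
    by (force simp: laminar_lists_def in_set_conv_nth dest: laminar_le)
  show "finite {r. set r \<subseteq> {..n} \<and> length r = n}"
    by (rule finite_lists_length_eq) simp
qed

text \<open>Inverse of the splitting at the interval \<open>[k, n]\<close> with the largest right end.\<close>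

definition laminar_join :: "nat \<Rightarrow> nat list \<times> nat list \<Rightarrow> nat list" where
  "laminar_join k = (\<lambda>(u, v). u @ map ((+) k) v @ [k])"

lemma laminar_laminar_join:
  assumes "laminar u" and "laminar v" and "length u = k"
  shows "laminar (laminar_join k (u, v))"
  unfolding laminar_def
proof (intro allI impI conjI)
  let ?r = "laminar_join k (u, v)"
  have nth: "?r ! z = (if z < k then u ! z else if z < k + length v then k + v ! (z - k) else k)"
    if "z < length ?r" for z
    using that assms(3) by (auto simp: laminar_join_def nth_append)
  have len: "length ?r = Suc (k + length v)"
    using assms(3) by (simp add: laminar_join_def)
  fix z assume z: "z < length ?r"
  show "?r ! z \<le> z"
    using z len nth[OF z] laminar_le[OF assms(1), of z] laminar_le[OF assms(2), of "z - k"]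
      assms(3) by (auto split: if_splits; linarith)
  fix y assume y: "y < z" and le: "?r ! z \<le> y"
  have ny: "?r ! y = (if y < k then u ! y else k + v ! (y - k))"
    using nth[of y] y z len by auto
  consider "z < k" | "k \<le> z" "z < k + length v" | "z = k + length v"
    using z len by linarith
  then show "?r ! z \<le> ?r ! y"
  proof cases
    case 1
    then show ?thesis
      using y le ny nth[OF z] laminar_nested[OF assms(1) y] assms(3) by simp
  next
    case 2
    then show ?thesis
      using y le ny nth[OF z] laminar_nested[OF assms(2), of "y - k" "z - k"] by auto
  next
    case 3
    then show ?thesis
      using le ny nth[OF z] by (auto split: if_splits)
  qed
qed

text \<open>
  The right ends in \<open>{r ! n..<n}\<close> lie in the last interval, so by nesting their intervals are
  contained in it, and the subtraction that shifts them to the origin does not truncate.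
\<close>

lemma laminar_split_last:
  assumes "laminar r" and "length r = Suc n"
  obtains u v where "laminar u" "laminar v" "length u = r ! n" "length v = n - r ! n"
    "r = laminar_join (r ! n) (u, v)"
proof
  let ?k = "r ! n"
  let ?u = "take ?k r"
  let ?v = "map (\<lambda>i. r ! (?k + i) - ?k) [0..<n - ?k]"
  have k: "?k \<le> n"
    using laminar_le[OF assms(1), of n] assms(2) by simp
  have ge: "?k \<le> r ! y" if "?k \<le> y" "y < n" for y
    using laminar_nested[OF assms(1), of y n] that assms(2) by simp
  show "laminar ?u"
    using assms k unfolding laminar_def by simp
  show "length ?u = ?k" "length ?v = n - ?k"
    using assms k by simp_all
  show "laminar ?v"
    unfolding laminar_def
  proof (intro allI impI conjI)
    fix z assume z: "z < length ?v"
    show "?v ! z \<le> z"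
      using z laminar_le[OF assms(1), of "?k + z"] assms(2) by (simp add: le_diff_conv add.commute)
    fix y assume y: "y < z" and le: "?v ! z \<le> y"
    have "r ! (?k + z) \<le> ?k + y"
      using le z by simp
    then have "r ! (?k + z) \<le> r ! (?k + y)"
      using laminar_nested[OF assms(1), of "?k + y" "?k + z"] y z assms(2) by simp
    then show "?v ! z \<le> ?v ! y"
      using y z by simp
  qed
  show "r = laminar_join ?k (?u, ?v)"
  proof (rule nth_equalityI)
    show "length r = length (laminar_join ?k (?u, ?v))"
      using assms k by (simp add: laminar_join_def)
    fix i assume i: "i < length r"
    then consider "i < ?k" | "?k \<le> i" "i < n" | "i = n"
      using assms(2) by linarith
    then show "r ! i = laminar_join ?k (?u, ?v) ! i"
      using assms k ge[of i] by cases (auto simp: laminar_join_def nth_append)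
  qed
qed

lemma bij_betw_laminar_join:
  "bij_betw (\<lambda>(k, p). laminar_join k p)
     (SIGMA k:{0..n}. laminar_lists k \<times> laminar_lists (n - k)) (laminar_lists (Suc n))"
    (is "bij_betw ?f ?A ?B")
proof (rule bij_betw_imageI)
  show "inj_on ?f ?A"
    by (auto simp: inj_on_def laminar_join_def laminar_lists_def)
  show "?f ` ?A = ?B"
  proof
    show "?f ` ?A \<subseteq> ?B"
      by (force simp: laminar_lists_def laminar_join_def
            dest: laminar_laminar_join[unfolded laminar_join_def prod.case])
    show "?B \<subseteq> ?f ` ?A"
    proof
      fix r assume "r \<in> ?B"
      then have r: "laminar r" "length r = Suc n"
        by (auto simp: laminar_lists_def)
      then obtain u v where uv: "laminar u" "laminar v" "length u = r ! n"
        "length v = n - r ! n" "r = laminar_join (r ! n) (u, v)"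
        by (rule laminar_split_last)
      have "r ! n \<le> n"
        using laminar_le[OF r(1)] r(2) by simp
      then have "(r ! n, u, v) \<in> ?A"
        using uv by (simp add: laminar_lists_def)
      then show "r \<in> ?f ` ?A"
        using uv(5) by (intro image_eqI[of _ _ "(r ! n, u, v)"]) simp_all
    qed
  qed
qed

lemma card_laminar_Suc:
  "card (laminar_lists (Suc n)) =
     (\<Sum>k=0..n. card (laminar_lists k) * card (laminar_lists (n - k)))"
  unfolding bij_betw_same_card[OF bij_betw_laminar_join, symmetric]
  by (simp add: card_cartesian_product finite_laminar_lists)

lemma card_laminar_0: "card (laminar_lists 0) = 1"
proof -
  have "laminar_lists 0 = {[]}"
    by (auto simp: laminar_lists_def laminar_def)
  then show ?thesis
    by simp
qed

section \<open>Isomorphism of Catalan pairs\<close>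

lemma catalan_isomorphic_refl: "catalan_isomorphic P P"
  by (cases P) (auto simp: catalan_isomorphic_def intro!: exI[of _ id])

lemma catalan_isomorphic_sym:
  assumes "catalan_isomorphic P Q"
  shows "catalan_isomorphic Q P"
proof -
  obtain X S R Y T U where PQ: "P = (X, S, R)" "Q = (Y, T, U)"
    by (cases P, cases Q)
  obtain f where f: "bij_betw f X Y"
    "\<And>x y. x \<in> X \<Longrightarrow> y \<in> X \<Longrightarrow> (x, y) \<in> S \<longleftrightarrow> (f x, f y) \<in> T"
    "\<And>x y. x \<in> X \<Longrightarrow> y \<in> X \<Longrightarrow> (x, y) \<in> R \<longleftrightarrow> (f x, f y) \<in> U"
    using assms unfolding PQ catalan_isomorphic_def by auto
  have g: "bij_betw (inv_into X f) Y X"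
    by (rule bij_betw_inv_into[OF f(1)])
  have "f (inv_into X f y) = y" "inv_into X f y \<in> X" if "y \<in> Y" for y
    using that bij_betw_inv_into_right[OF f(1)] bij_betwE[OF g] by auto
  then show ?thesis
    unfolding PQ catalan_isomorphic_def prod.case
    by (intro exI[of _ "inv_into X f"]) (simp add: f(2,3) g)
qed

lemma catalan_isomorphic_trans:
  assumes "catalan_isomorphic P Q" and "catalan_isomorphic Q Q'"
  shows "catalan_isomorphic P Q'"
proof -
  obtain X S R Y T U Z V W where PQ: "P = (X, S, R)" "Q = (Y, T, U)" "Q' = (Z, V, W)"
    by (cases P, cases Q, cases Q')
  obtain f where f: "bij_betw f X Y"
    "\<And>x y. x \<in> X \<Longrightarrow> y \<in> X \<Longrightarrow> (x, y) \<in> S \<longleftrightarrow> (f x, f y) \<in> T"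
    "\<And>x y. x \<in> X \<Longrightarrow> y \<in> X \<Longrightarrow> (x, y) \<in> R \<longleftrightarrow> (f x, f y) \<in> U"
    using assms(1) unfolding PQ catalan_isomorphic_def by auto
  obtain g where g: "bij_betw g Y Z"
    "\<And>x y. x \<in> Y \<Longrightarrow> y \<in> Y \<Longrightarrow> (x, y) \<in> T \<longleftrightarrow> (g x, g y) \<in> V"
    "\<And>x y. x \<in> Y \<Longrightarrow> y \<in> Y \<Longrightarrow> (x, y) \<in> U \<longleftrightarrow> (g x, g y) \<in> W"
    using assms(2) unfolding PQ catalan_isomorphic_def by auto
  show ?thesis
    unfolding PQ catalan_isomorphic_def prod.case
    by (intro exI[of _ "g \<circ> f"])
      (simp add: f(2,3) g(2,3) bij_betw_trans[OF f(1) g(1)] bij_betw_apply[OF f(1)])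
qed

lemma equiv_catalan_iso_rel: "equiv (catalan_pairs n) (catalan_iso_rel n)"
proof (rule equivI)
  show "catalan_iso_rel n \<subseteq> catalan_pairs n \<times> catalan_pairs n"
    by (auto simp: catalan_iso_rel_def)
  show "refl_on (catalan_pairs n) (catalan_iso_rel n)"
    by (auto simp: refl_on_def catalan_iso_rel_def catalan_isomorphic_refl)
  show "sym (catalan_iso_rel n)"
    by (auto simp: sym_def catalan_iso_rel_def catalan_isomorphic_sym)
  show "trans (catalan_iso_rel n)"
    unfolding trans_def catalan_iso_rel_def by (blast intro: catalan_isomorphic_trans)
qed

section \<open>The linear order of a Catalan pair\<close>

lemma catalan_pairD:
  assumes "catalan_pair X S R"
  shows "finite X" "S \<subseteq> X \<times> X" "R \<subseteq> X \<times> X" "irrefl S" "irrefl R" "trans S" "trans R"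
    "S O R \<subseteq> R"
  using assms by (auto simp: catalan_pair_def strict_order_on_def)

lemma catalan_pair_total:
  assumes "catalan_pair X S R" "x \<in> X" "y \<in> X" "x \<noteq> y"
  shows "(x, y) \<in> S \<or> (y, x) \<in> S \<or> (x, y) \<in> R \<or> (y, x) \<in> R"
proof -
  have "(x, y) \<in> sym_hull R \<union> sym_hull S"
    using assms by (auto simp: catalan_pair_def)
  then show ?thesis
    by (auto simp: sym_hull_def)
qed

lemma catalan_pair_disjoint:
  assumes "catalan_pair X S R" "(x, y) \<in> S"
  shows "(x, y) \<notin> R" "(y, x) \<notin> R"
  using assms by (auto simp: catalan_pair_def sym_hull_def)

text \<open>
  The composition \<open>S O R\<close> is covered by (comp). For \<open>x R y S z\<close>, each way in which \<open>x\<close> might fail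
  to precede \<open>z\<close> can be composed with \<open>y S z\<close>, and the result relates \<open>y\<close> to \<open>x\<close>, against
  \<open>x R y\<close>.
\<close>

lemma catalan_pair_trans_Un:
  assumes "catalan_pair X S R"
  shows "trans (S \<union> R)"
proof (rule transI)
  note c = catalan_pairD[OF assms] and disj = catalan_pair_disjoint[OF assms]
  fix x y z assume xy: "(x, y) \<in> S \<union> R" and yz: "(y, z) \<in> S \<union> R"
  show "(x, z) \<in> S \<union> R"
  proof (cases "(x, y) \<in> R \<and> (y, z) \<in> S")
    case False
    then show ?thesis
      using xy yz c(6-8) by (auto dest: transD)
  next
    case True
    have "x \<noteq> z"
      using True disj by auto
    moreover have "x \<in> X" "z \<in> X"
      using True c(2,3) by auto
    moreover have "(z, x) \<notin> S"
      using True disj c(6) by (meson transD)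
    moreover have "(z, x) \<notin> R"
    proof
      assume "(z, x) \<in> R"
      then have "(y, x) \<in> R"
        using True c(8) by auto
      then show False
        using True c(5,7) by (meson irrefl_def transD)
    qed
    ultimately show ?thesis
      using catalan_pair_total[OF assms] by blast
  qed
qed

lemma catalan_pair_total_Un:
  assumes "catalan_pair X S R"
  shows "total_on X (S \<union> R)"
  using catalan_pair_total[OF assms] by (auto simp: total_on_def)

lemma finite_linear_order_rank:
  assumes "finite X" "L \<subseteq> X \<times> X" "irrefl L" "trans L" "total_on X L"
  obtains f where "bij_betw f X {..<card X}"
    "\<And>x y. x \<in> X \<Longrightarrow> y \<in> X \<Longrightarrow> (x, y) \<in> L \<longleftrightarrow> f x < (f y :: nat)"
proof
  let ?f = "\<lambda>x. card {w. (w, x) \<in> L}"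
  have sub: "{w. (w, x) \<in> L} \<subseteq> X" for x
    using assms(2) by auto
  have fin: "finite {w. (w, x) \<in> L}" for x
    by (rule finite_subset[OF sub assms(1)])
  have less: "?f x < ?f y" if "(x, y) \<in> L" for x y
  proof (rule psubset_card_mono[OF fin])
    show "{w. (w, x) \<in> L} \<subset> {w. (w, y) \<in> L}"
      using that assms(3,4) by (auto simp: irrefl_def dest: transD)
  qed
  show iff: "(x, y) \<in> L \<longleftrightarrow> ?f x < ?f y" if "x \<in> X" "y \<in> X" for x y
    using that less[of x y] less[of y x] assms(5) unfolding total_on_def
    by (metis less_asym)
  have inj: "inj_on ?f X"
    using less assms(5) unfolding total_on_def inj_on_def by (metis less_irrefl)
  have "?f x < card X" if "x \<in> X" for x
  proof (rule psubset_card_mono[OF assms(1)])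
    show "{w. (w, x) \<in> L} \<subset> X"
      using that sub[of x] assms(3) by (auto simp: irrefl_def)
  qed
  then have "?f ` X \<subseteq> {..<card X}"
    by auto
  then have "?f ` X = {..<card X}"
    by (rule card_subset_eq[rotated]) (simp_all add: card_image[OF inj])
  with inj show "bij_betw ?f X {..<card X}"
    by (rule bij_betw_imageI)
qed

lemma downward_closed_eq_lessThan_card:
  fixes A :: "nat set"
  assumes "finite A" and "\<And>x y. y \<in> A \<Longrightarrow> x < y \<Longrightarrow> x \<in> A"
  shows "A = {..<card A}"
proof (cases "A = {}")
  case False
  then have "Max A \<in> A"
    using Max_in[OF assms(1)] by simp
  then have "A = {..Max A}"
    using assms(2)[of "Max A"] Max_ge[OF assms(1)] by (auto simp: le_less)
  then show ?thesis
    by (metis card_atMost lessThan_Suc_atMost)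
qed simp

section \<open>Standard Catalan pairs\<close>

text \<open>
  The element \<open>z\<close> is put above the elements before its interval \<open>[r ! z, z]\<close> by \<open>R\<close>, and above
  the other elements of that interval by \<open>S\<close>.
\<close>

definition standard_pair :: "nat list \<Rightarrow> nat set \<times> nat rel \<times> nat rel" where
  "standard_pair r =
     ({..<length r}, {(x, z). z < length r \<and> r ! z \<le> x \<and> x < z}, {(x, z). z < length r \<and> x < r ! z})"

lemma standard_pair_in_catalan_pairs:
  assumes "r \<in> laminar_lists n"
  shows "standard_pair r \<in> catalan_pairs n"
proof -
  let ?S = "{(x, z). z < length r \<and> r ! z \<le> x \<and> x < z}"
  let ?R = "{(x, z). z < length r \<and> x < r ! z}"
  have r: "laminar r" "length r = n"
    using assms by (auto simp: laminar_lists_def)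
  note le = laminar_le[OF r(1)]
  have "strict_order_on {..<length r} ?S"
    unfolding strict_order_on_def
  proof (intro conjI)
    show "trans ?S"
    proof (rule transI)
      fix x y z assume "(x, y) \<in> ?S" "(y, z) \<in> ?S"
      then show "(x, z) \<in> ?S"
        using laminar_nested[OF r(1), of y z] by auto
    qed
  qed (auto simp: irrefl_def)
  moreover have "strict_order_on {..<length r} ?R"
    unfolding strict_order_on_def
  proof (intro conjI)
    show "?R \<subseteq> {..<length r} \<times> {..<length r}" "irrefl ?R" "trans ?R"
      using le by (fastforce simp: irrefl_def trans_def)+
  qed
  moreover have "sym_hull ?R \<union> sym_hull ?S = {..<length r} \<times> {..<length r} - Id_on {..<length r}"
    (is "?T = _")
  proof -
    have "(x, z) \<in> ?T \<longleftrightarrow> x < length r \<and> z < length r \<and> x \<noteq> z" for x z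
      using le[of x] le[of z] by (auto simp: sym_hull_def)
    then show ?thesis
      by auto
  qed
  moreover have "sym_hull ?R \<inter> sym_hull ?S = {}"
  proof -
    have "(x, z) \<notin> sym_hull ?R \<inter> sym_hull ?S" for x z
      using le[of x] le[of z] by (auto simp: sym_hull_def)
    then show ?thesis
      by auto
  qed
  moreover have "?S O ?R \<subseteq> ?R"
    by auto
  ultimately show ?thesis
    using r(2) by (simp add: catalan_pairs_def catalan_pair_def standard_pair_def)
qed

text \<open>
  An isomorphism preserves \<open>S \<union> R\<close>, which is \<open><\<close> on both sides, and the only order automorphism
  of \<open>{..<n}\<close> is the identity.
\<close>

lemma standard_pair_isomorphic_imp_eq:
  assumes "r \<in> laminar_lists n" "r' \<in> laminar_lists n"
    and "catalan_isomorphic (standard_pair r) (standard_pair r')"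
  shows "r = r'"
proof -
  have len: "length r = n" "length r' = n" and lam: "laminar r" "laminar r'"
    using assms(1,2) by (auto simp: laminar_lists_def)
  obtain f where f: "bij_betw f {..<n} {..<n}"
    and S: "\<And>x y. x < n \<Longrightarrow> y < n \<Longrightarrow> r ! y \<le> x \<and> x < y \<longleftrightarrow> r' ! f y \<le> f x \<and> f x < f y \<and> f y < n"
    and R: "\<And>x y. x < n \<Longrightarrow> y < n \<Longrightarrow> x < r ! y \<longleftrightarrow> f x < r' ! f y \<and> f y < n"
    using assms(3) by (auto simp: standard_pair_def catalan_isomorphic_def len)
  have fn: "f x < n" if "x < n" for x
    using bij_betwE[OF f] that by simp
  have mono: "x < y \<longleftrightarrow> f x < f y" if "x < n" "y < n" for x y
    using S[OF that] R[OF that] fn[OF that(2)] laminar_le[OF lam(1), of y]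
      laminar_le[OF lam(2), of "f y"] that len by linarith
  have id: "f x = x" if "x < n" for x
  proof -
    have "f ` {..<x} = {..<f x}"
    proof (intro equalityI subsetI)
      fix w assume "w \<in> f ` {..<x}"
      then obtain v where "w = f v" "v < x"
        by auto
      then show "w \<in> {..<f x}"
        using that mono[of v x] by simp
    next
      fix w assume "w \<in> {..<f x}"
      then have w: "w < f x" "w \<in> {..<n}"
        using fn[OF that] by auto
      then obtain v where "v < n" "w = f v"
        using bij_betw_imp_surj_on[OF f] by auto
      then show "w \<in> f ` {..<x}"
        using w(1) mono[of v x] that by simp
    qed
    moreover have "inj_on f {..<x}"
      by (rule inj_on_subset[OF bij_betw_imp_inj_on[OF f]]) (use that in auto)
    ultimately show ?thesis
      using card_image[of f "{..<x}"] by simp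
  qed
  show ?thesis
  proof (rule nth_equalityI)
    fix z assume "z < length r"
    then have z: "z < n"
      using len by simp
    have "x < r ! z \<longleftrightarrow> x < r' ! z" if "x < n" for x
      using R[OF that z] id that z by simp
    moreover have "r ! z < n" "r' ! z < n"
      using z laminar_le lam len by (metis le_less_trans)+
    ultimately show "r ! z = r' ! z"
      by (meson linorder_neqE_nat less_irrefl)
  qed (simp add: len)
qed

text \<open>
  Once \<open>S \<union> R\<close> is the usual order, \<open>x < y R z\<close> gives \<open>x R z\<close> in either case for the pair
  \<open>(x, y)\<close>, by (comp) or by transitivity of \<open>R\<close>. Hence \<open>R\<close> is determined by its in-degrees.
\<close>

lemma catalan_pair_lessThan_eq_standard_pair:
  assumes cp: "catalan_pair {..<n} S R"
    and ord: "\<And>x y. x < n \<Longrightarrow> y < n \<Longrightarrow> (x, y) \<in> S \<union> R \<longleftrightarrow> x < y"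
  shows "\<exists>r \<in> laminar_lists n. ({..<n}, S, R) = standard_pair r"
proof -
  note c = catalan_pairD[OF cp] and disj = catalan_pair_disjoint[OF cp]
  define r where "r = map (\<lambda>z. card {x. (x, z) \<in> R}) [0..<n]"
  have R_down: "(x, z) \<in> R" if "(y, z) \<in> R" "x < y" for x y z
  proof -
    have "(x, y) \<in> S \<union> R"
      using that c(3) ord[of x y] by auto
    then show ?thesis
      using that c(7,8) by (auto dest: transD)
  qed
  have Rz: "{x. (x, z) \<in> R} = {..<card {x. (x, z) \<in> R}}" for z
  proof (rule downward_closed_eq_lessThan_card)
    show "finite {x. (x, z) \<in> R}"
      by (rule finite_subset[of _ "{..<n}"]) (use c(3) in auto)
  qed (use R_down in blast)
  have R: "(x, z) \<in> R \<longleftrightarrow> z < n \<and> x < r ! z" for x z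
  proof (cases "z < n")
    case True
    then show ?thesis
      using Rz[of z] by (auto simp: r_def)
  qed (use c(3) in auto)
  have S: "(x, z) \<in> S \<longleftrightarrow> z < n \<and> r ! z \<le> x \<and> x < z" for x z
  proof (cases "x < n \<and> z < n")
    case True
    then show ?thesis
      using ord[of x z] disj(1)[of x z] R[of x z] by auto
  qed (use c(2) in auto)
  have len: "length r = n"
    by (simp add: r_def)
  have "laminar r"
    unfolding laminar_def len
  proof (intro allI impI conjI)
    fix z assume z: "z < n"
    show "r ! z \<le> z"
      using R[of z z] c(5) z by (auto simp: irrefl_def)
    fix y assume y: "y < z" "r ! z \<le> y"
    show "r ! z \<le> r ! y"
    proof (rule ccontr)
      assume "\<not> r ! z \<le> r ! y"
      \<comment> \<open>The left end \<open>r ! y\<close> would then be an \<open>S\<close>-predecessor of \<open>y\<close>, hence of \<open>z\<close>, lying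
        outside the interval of \<open>z\<close>.\<close>
      then have "(r ! y, y) \<in> S" "(y, z) \<in> S" "(r ! y, z) \<notin> S"
        using S y z by auto
      then show False
        using c(6) by (meson transD)
    qed
  qed
  moreover have "({..<n}, S, R) = standard_pair r"
    using R S by (auto simp: standard_pair_def len)
  ultimately show ?thesis
    using len by (auto simp: laminar_lists_def)
qed

lemma catalan_pair_isomorphic_standard_pair:
  assumes "catalan_pair X S R"
  obtains r where "r \<in> laminar_lists (card X)" "catalan_isomorphic (X, S, R) (standard_pair r)"
proof -
  note c = catalan_pairD[OF assms]
  have "irrefl (S \<union> R)" "S \<union> R \<subseteq> X \<times> X"
    using c by (auto simp: irrefl_def)
  then obtain f where f: "bij_betw f X {..<card X}"
    and ord: "\<And>x y. x \<in> X \<Longrightarrow> y \<in> X \<Longrightarrow> (x, y) \<in> S \<union> R \<longleftrightarrow> f x < (f y :: nat)"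
    using finite_linear_order_rank c(1) catalan_pair_trans_Un[OF assms]
      catalan_pair_total_Un[OF assms] by metis
  have inj: "inj_on f X" and im: "f ` X = {..<card X}"
    using f by (auto simp: bij_betw_def)
  let ?S = "map_prod f f ` S" and ?R = "map_prod f f ` R"
  have "(u, v) \<in> ?S \<union> ?R \<longleftrightarrow> u < v" if "u < card X" "v < card X" for u v
  proof
    assume "(u, v) \<in> ?S \<union> ?R"
    then show "u < v"
      using ord c(2,3) by fastforce
  next
    assume "u < v"
    have "u \<in> f ` X" "v \<in> f ` X"
      using that im by simp_all
    then obtain x y where xy: "x \<in> X" "y \<in> X" "u = f x" "v = f y"
      by blast
    then have "(x, y) \<in> S \<union> R"
      using \<open>u < v\<close> ord[of x y] by blast
    then have "map_prod f f (x, y) \<in> map_prod f f ` (S \<union> R)"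
      by (rule imageI)
    then show "(u, v) \<in> ?S \<union> ?R"
      using xy by (simp add: image_Un)
  qed
  with catalan_isomorphic_pair(1)[OF assms inj, unfolded im]
  have "\<exists>r \<in> laminar_lists (card X). ({..<card X}, ?S, ?R) = standard_pair r"
    by (rule catalan_pair_lessThan_eq_standard_pair)
  then obtain r where "r \<in> laminar_lists (card X)" "({..<card X}, ?S, ?R) = standard_pair r"
    by blast
  then show thesis
    using that catalan_isomorphic_pair(2)[OF assms inj] unfolding im by simp
qed

section \<open>Counting the classes\<close>

lemma card_catalan_classes: "card (catalan_classes n) = card (laminar_lists n)"
proof -
  note eq = equiv_catalan_iso_rel[of n]
  let ?cls = "\<lambda>r. catalan_iso_rel n `` {standard_pair r}"
  have "inj_on ?cls (laminar_lists n)"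
  proof (rule inj_onI)
    fix r r' assume r: "r \<in> laminar_lists n" "r' \<in> laminar_lists n" and "?cls r = ?cls r'"
    then have "(standard_pair r, standard_pair r') \<in> catalan_iso_rel n"
      using eq_equiv_class[OF _ eq] standard_pair_in_catalan_pairs by blast
    then show "r = r'"
      using standard_pair_isomorphic_imp_eq[OF r] by (simp add: catalan_iso_rel_def)
  qed
  moreover have "?cls ` laminar_lists n = catalan_classes n"
  proof
    show "?cls ` laminar_lists n \<subseteq> catalan_classes n"
      unfolding catalan_classes_def by (auto intro: quotientI standard_pair_in_catalan_pairs)
    show "catalan_classes n \<subseteq> ?cls ` laminar_lists n"
    proof
      fix K assume "K \<in> catalan_classes n"
      then obtain X S R where P: "(X, S, R) \<in> catalan_pairs n"
        and K: "K = catalan_iso_rel n `` {(X, S, R)}"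
        unfolding catalan_classes_def by (auto elim!: quotientE)
      have "catalan_pair X S R" and n: "card X = n"
        using P by (auto simp: catalan_pairs_def)
      then obtain r where r: "r \<in> laminar_lists n"
        and "catalan_isomorphic (X, S, R) (standard_pair r)"
        by (metis catalan_pair_isomorphic_standard_pair)
      then have "((X, S, R), standard_pair r) \<in> catalan_iso_rel n"
        using P standard_pair_in_catalan_pairs by (simp add: catalan_iso_rel_def)
      then show "K \<in> ?cls ` laminar_lists n"
        using equiv_class_eq[OF eq] r K by blast
    qed
  qed
  ultimately show ?thesis
    using card_image by metis
qed

lemma catalan_number_0: "catalan_number 0 = 1"
  unfolding catalan_number_def by (subst catalan_gf_quadratic) simp

lemma catalan_number_Suc:
  "catalan_number (Suc n) = (\<Sum>k=0..n. catalan_number k * catalan_number (n - k))"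
  unfolding catalan_number_def
  by (subst catalan_gf_quadratic) (simp, simp add: power2_eq_square fps_mult_nth)

lemma real_card_laminar_lists: "real (card (laminar_lists n)) = catalan_number n"
proof (induction n rule: less_induct)
  case (less n)
  show ?case
  proof (cases n)
    case 0
    then show ?thesis
      by (simp add: card_laminar_0 catalan_number_0)
  next
    case (Suc m)
    then show ?thesis
      using less.IH by (simp add: card_laminar_Suc catalan_number_Suc)
  qed
qed

theorem proposition2p6:
  shows "(\<forall>n. card (catalan_classes (n + 1)) =
               (\<Sum>k=0..n. card (catalan_classes k) * card (catalan_classes (n - k)))) \<and>
         card (catalan_classes 0) = 1 \<and>
         (\<forall>n. real (card (catalan_classes n)) = catalan_number n)"
  by (simp add: card_catalan_classes card_laminar_Suc card_laminar_0 real_card_laminar_lists)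

end
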